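(* Let $n\ge1$ and let $\lambda=\sum_{i=1}^{n+1}\lambda_i\omega_i$ be any dominant integral weight of $\mathfrak{sl}(n+2)$. The restriction $V(\lambda)_\Phi$ of the irreducible $\mathfrak{sl}(n+2)$-module $V(\lambda)$ to $\mathfrak{sl}(n+1)\ltimes\mathbb{C}^{n+1}$ is a cyclic module, generated by the $\mathfrak{sl}(n+2)$-highest weight vector $v_\lambda$ of $V(\lambda)$, whose $\mathfrak{sl}(n+1)$-weight is $\lambda_0=\sum_{k=2}^{n+1}\lambda_k\omega_k$, i.e. $\Phi(H_i)v_\lambda=\lambda_{i+1}v_\lambda$ for $1\le i\le n$.
   Context: Everything is over $\mathbb{C}$; modules are finite dimensional. $A_{i,j}$ denotes a matrix unit. In $\mathfrak{sl}(n+1)$ put $E_{p,q}=A_{p,q+1}$, $F_{p,q}=A_{q+1,p}$ $(1\le p\le q\le n)$, $H_i=A_{i,i}-A_{i+1,i+1}$. $\mathfrak{g}=\mathfrak{sl}(n+1)\ltimes\mathbb{C}^{n+1}$ is the semidirect sum with the standard representation $\mathbb{C}^{n+1}$ (an abelian ideal) with standard basis $P_1,\dots,P_{n+1}$, so $[X,P_j]=XP_j$. The embedding $\Phi:\mathfrak{g}\to\mathfrak{sl}(n+2)$ is $\Phi(H_i)=A_{i+1,i+1}-A_{i+2,i+2}$, $\Phi(E_{p,q})=A_{p+1,q+2}$, $\Phi(F_{p,q})=A_{q+2,p+1}$, $\Phi(P_j)=A_{j+1,1}$. $\omega_1,\dots,\omega_{n+1}$ are the fundamental weights of $\mathfrak{sl}(n+2)$;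 when speaking of weights of the subalgebra $\Phi(\mathfrak{sl}(n+1))$, $\omega_k$ with $2\le k\le n+1$ is identified with the $(k-1)$-st fundamental weight of $\mathfrak{sl}(n+1)$. $V(\lambda)_\Phi$ is $V(\lambda)$ viewed as a $\mathfrak{g}$-module via $\Phi$. A $\mathfrak{g}$-module $M$ is cyclic with generator $v$ if $M=\mathcal{U}(\mathfrak{g})v$. *)

theory Defs
  imports
    Complex_Main
    "HOL-Library.Poly_Mapping"
    "Jordan_Normal_Form.Matrix"
begin

section \<open>Lie algebras and their finite-dimensional modules\<close>

text \<open>Lie algebras are carrier-based, because the rank \<open>n\<close> is a variable. Modules live on a
  full type \<open>'v\<close> with an explicit scalar multiplication, as in \<^theory>\<open>HOL.Vector_Spaces\<close>.\<close>

record 'x lie_alg =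
  carr :: "'x set"
  ladd :: "'x \<Rightarrow> 'x \<Rightarrow> 'x"
  lsmult :: "complex \<Rightarrow> 'x \<Rightarrow> 'x"
  lbracket :: "'x \<Rightarrow> 'x \<Rightarrow> 'x"

locale lie_module = vector_space scale
  for L :: "'x lie_alg" and scale :: "complex \<Rightarrow> 'v::ab_group_add \<Rightarrow> 'v" +
  fixes rho :: "'x \<Rightarrow> 'v \<Rightarrow> 'v"
  assumes finite_dim: "\<exists>B. finite_dimensional_vector_space scale B"
    and rho_linear: "x \<in> carr L \<Longrightarrow> Vector_Spaces.linear scale scale (rho x)"
    and rho_add: "x \<in> carr L \<Longrightarrow> y \<in> carr L \<Longrightarrow> rho (ladd L x y) m = rho x m + rho y m"
    and rho_smult: "x \<in> carr L \<Longrightarrow> rho (lsmult L c x) m = scale c (rho x m)"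
    and rho_bracket: "x \<in> carr L \<Longrightarrow> y \<in> carr L \<Longrightarrow>
          rho (lbracket L x y) m = rho x (rho y m) - rho y (rho x m)"

definition irreducible_lie_module ::
  "'x lie_alg \<Rightarrow> (complex \<Rightarrow> 'v::ab_group_add \<Rightarrow> 'v) \<Rightarrow> ('x \<Rightarrow> 'v \<Rightarrow> 'v) \<Rightarrow> bool" where
  "irreducible_lie_module L scale rho \<longleftrightarrow>
     lie_module L scale rho \<and> (\<exists>m::'v. m \<noteq> 0) \<and>
     (\<forall>S. module.subspace scale S \<and> (\<forall>x\<in>carr L. \<forall>m\<in>S. rho x m \<in> S) \<longrightarrow> S = {0} \<or> S = UNIV)"

section \<open>The universal enveloping algebra and cyclic modules\<close>

text \<open>Finitely supported functions on words, with convolution, form the free unital associative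
  algebra on the letters. The universal enveloping algebra is its quotient by the two-sided ideal
  generated by the linear relations of \<open>L\<close> and by \<open>xy - yx - [x,y]\<close>; this is the usual
  \<open>T(L)/I\<close>, the linear relations turning words into tensors.\<close>

datatype 'x word = Word (letters: "'x list")

instantiation word :: (type) monoid_add
begin
definition "0 = Word []"
definition "u + w = Word (letters u @ letters w)"
instance
  by standard (simp_all add: zero_word_def plus_word_def)
end

definition free_alg :: "'x lie_alg \<Rightarrow> ('x word \<Rightarrow>\<^sub>0 complex) set" where
  "free_alg L = {f. \<forall>w\<in>Poly_Mapping.keys f. set (letters w) \<subseteq> carr L}"

definition gen :: "complex \<Rightarrow> 'x \<Rightarrow> 'x word \<Rightarrow>\<^sub>0 complex" where
  "gen c x = Poly_Mapping.single (Word [x]) c"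

inductive_set env_ideal :: "'x lie_alg \<Rightarrow> ('x word \<Rightarrow>\<^sub>0 complex) set"
  for L :: "'x lie_alg" where
  rel_add: "x \<in> carr L \<Longrightarrow> y \<in> carr L \<Longrightarrow> gen 1 (ladd L x y) - gen 1 x - gen 1 y \<in> env_ideal L"
| rel_smult: "x \<in> carr L \<Longrightarrow> gen 1 (lsmult L c x) - gen c x \<in> env_ideal L"
| rel_bracket: "x \<in> carr L \<Longrightarrow> y \<in> carr L \<Longrightarrow>
     gen 1 x * gen 1 y - gen 1 y * gen 1 x - gen 1 (lbracket L x y) \<in> env_ideal L"
| ideal_add: "f \<in> env_ideal L \<Longrightarrow> g \<in> env_ideal L \<Longrightarrow> f + g \<in> env_ideal L"
| ideal_left: "a \<in> free_alg L \<Longrightarrow> f \<in> env_ideal L \<Longrightarrow> a * f \<in> env_ideal L"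
| ideal_right: "a \<in> free_alg L \<Longrightarrow> f \<in> env_ideal L \<Longrightarrow> f * a \<in> env_ideal L"

definition env_alg :: "'x lie_alg \<Rightarrow> ('x word \<Rightarrow>\<^sub>0 complex) set set" where
  "env_alg L = free_alg L // {(f, g). f \<in> free_alg L \<and> g \<in> free_alg L \<and> f - g \<in> env_ideal L}"

definition word_act :: "('x \<Rightarrow> 'v \<Rightarrow> 'v) \<Rightarrow> 'x word \<Rightarrow> 'v \<Rightarrow> 'v" where
  "word_act rho w m = foldr rho (letters w) m"

definition free_act :: "(complex \<Rightarrow> 'v::ab_group_add \<Rightarrow> 'v) \<Rightarrow> ('x \<Rightarrow> 'v \<Rightarrow> 'v)
    \<Rightarrow> ('x word \<Rightarrow>\<^sub>0 complex) \<Rightarrow> 'v \<Rightarrow> 'v" where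
  "free_act scale rho f m =
     (\<Sum>w\<in>Poly_Mapping.keys f. scale (Poly_Mapping.lookup f w) (word_act rho w m))"

text \<open>The action of a class of the quotient is the common value of the action of its
  representatives; it is well defined by \<open>env_act_class\<close>, which applies to the restricted
  modules of the last section by \<open>restrict_Phi_module\<close>.\<close>

definition env_act :: "(complex \<Rightarrow> 'v::ab_group_add \<Rightarrow> 'v) \<Rightarrow> ('x \<Rightarrow> 'v \<Rightarrow> 'v)
    \<Rightarrow> ('x word \<Rightarrow>\<^sub>0 complex) set \<Rightarrow> 'v \<Rightarrow> 'v" where
  "env_act scale rho u m = (THE m'. \<forall>f\<in>u. free_act scale rho f m = m')"

definition cyclic_lie_module :: "'x lie_alg \<Rightarrow> (complex \<Rightarrow> 'v::ab_group_add \<Rightarrow> 'v)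
    \<Rightarrow> ('x \<Rightarrow> 'v \<Rightarrow> 'v) \<Rightarrow> 'v \<Rightarrow> bool" where
  "cyclic_lie_module L scale rho v \<longleftrightarrow>
     lie_module L scale rho \<and> UNIV = {env_act scale rho u v | u. u \<in> env_alg L}"

lemma free_alg_zero: "0 \<in> free_alg L"
  by (simp add: free_alg_def)

lemma free_alg_add: "f \<in> free_alg L \<Longrightarrow> g \<in> free_alg L \<Longrightarrow> f + g \<in> free_alg L"
  unfolding free_alg_def using Poly_Mapping.keys_add[of f g] by blast

lemma free_alg_diff: "f \<in> free_alg L \<Longrightarrow> g \<in> free_alg L \<Longrightarrow> f - g \<in> free_alg L"
  unfolding free_alg_def using Poly_Mapping.keys_diff[of f g] by blast

lemma free_alg_mult: "f \<in> free_alg L \<Longrightarrow> g \<in> free_alg L \<Longrightarrow> f * g \<in> free_alg L"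
  unfolding free_alg_def using Poly_Mapping.keys_mult[of f g]
  by (fastforce simp: plus_word_def)

lemma word_act_add: "word_act rho (u + w) m = word_act rho u (word_act rho w m)"
  by (simp add: word_act_def plus_word_def)

context lie_module
begin

lemma lin_hom:
  assumes "Vector_Spaces.linear scale scale f"
  shows "f (a + b) = f a + f b" "f (scale c a) = scale c (f a)" "f 0 = 0"
proof -
  interpret f: module_hom scale scale f
    using assms by (simp add: Vector_Spaces.linear_def)
  show "f (a + b) = f a + f b" "f (scale c a) = scale c (f a)" "f 0 = 0"
    by (rule f.add f.scale f.zero)+
qed

lemma free_act_superset:
  assumes "finite S" "Poly_Mapping.keys f \<subseteq> S"
  shows "free_act scale rho f m = (\<Sum>w\<in>S. scale (Poly_Mapping.lookup f w) (word_act rho w m))"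
  unfolding free_act_def using assms
  by (intro sum.mono_neutral_left) (auto simp: in_keys_iff)

lemma free_act_add: "free_act scale rho (f + g) m = free_act scale rho f m + free_act scale rho g m"
proof -
  let ?S = "Poly_Mapping.keys f \<union> Poly_Mapping.keys g"
  have "Poly_Mapping.keys (f + g) \<subseteq> ?S" by (rule Poly_Mapping.keys_add)
  then show ?thesis
    by (simp add: free_act_superset[of ?S] lookup_add scale_left_distrib sum.distrib)
qed

lemma free_act_diff: "free_act scale rho (f - g) m = free_act scale rho f m - free_act scale rho g m"
  using free_act_add[of "f - g" g m] by simp

lemma free_act_single: "free_act scale rho (Poly_Mapping.single w c) m = scale c (word_act rho w m)"
  by (cases "c = 0") (simp_all add: free_act_def)

lemma word_act_linear:
  assumes "set (letters w) \<subseteq> carr L"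
  shows "Vector_Spaces.linear scale scale (word_act rho w)"
proof -
  have "set xs \<subseteq> carr L \<Longrightarrow> Vector_Spaces.linear scale scale (foldr rho xs)" for xs
  proof (induction xs)
    case Nil
    then show ?case using linear_id by (simp add: id_def)
  next
    case (Cons x xs)
    then show ?case using Vector_Spaces.linear_compose[of scale scale "foldr rho xs" scale "rho x"]
        rho_linear[of x] by (simp add: comp_def)
  qed
  then show ?thesis using assms unfolding word_act_def by simp
qed

lemma free_act_linear:
  assumes "f \<in> free_alg L"
  shows "free_act scale rho f (m + m') = free_act scale rho f m + free_act scale rho f m'"
    and "free_act scale rho f (scale c m) = scale c (free_act scale rho f m)"
    and "free_act scale rho f 0 = 0"
proof -
  have *: "Vector_Spaces.linear scale scale (word_act rho w)" if "w \<in> Poly_Mapping.keys f" for w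
    using that assms word_act_linear by (auto simp: free_alg_def)
  show 1: "free_act scale rho f (m + m') = free_act scale rho f m + free_act scale rho f m'" for m m'
    unfolding free_act_def sum.distrib[symmetric]
    by (rule sum.cong) (simp_all add: lin_hom[OF *] scale_right_distrib)
  show "free_act scale rho f (scale c m) = scale c (free_act scale rho f m)"
    unfolding free_act_def scale_sum_right
    by (rule sum.cong) (simp_all add: lin_hom[OF *] mult.commute)
  show "free_act scale rho f 0 = 0" using 1[of 0 0] by simp
qed

lemma poly_mapping_split_induct [case_names zero add]:
  fixes f :: "'b \<Rightarrow>\<^sub>0 'c::ab_group_add"
  assumes "P 0" "\<And>w c f. w \<notin> Poly_Mapping.keys f \<Longrightarrow> P f \<Longrightarrow> P (Poly_Mapping.single w c + f)"
  shows "P f"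
proof (induction f rule: Poly_Mapping.update_induct)
  case const
  then show ?case using assms(1) by simp
next
  case (update f a b)
  have "Poly_Mapping.update a b f = Poly_Mapping.single a b + f"
    using update by (intro poly_mapping_eqI)
      (auto simp: lookup_update lookup_add lookup_single when_def in_keys_iff)
  then show ?case using assms(2) update by simp
qed

lemma free_act_mult:
  assumes "f \<in> free_alg L" "g \<in> free_alg L"
  shows "free_act scale rho (f * g) m = free_act scale rho f (free_act scale rho g m)"
proof -
  have 1: "free_act scale rho (Poly_Mapping.single w c * g) m
      = scale c (word_act rho w (free_act scale rho g m))"
    if w: "set (letters w) \<subseteq> carr L" for w c
  proof (induction g rule: poly_mapping_split_induct)
    case zero
    then show ?case using lin_hom[OF word_act_linear[OF w]] by (simp add: free_act_def)
  next
    case (add u d g)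
    then show ?case
      using lin_hom[OF word_act_linear[OF w]]
      by (simp add: distrib_left free_act_add mult_single free_act_single word_act_add
          scale_right_distrib)
  qed
  show ?thesis using assms(1)
  proof (induction f rule: poly_mapping_split_induct)
    case zero
    then show ?case by (simp add: free_act_def)
  next
    case (add w c f)
    show ?case
    proof (cases "c = 0")
      case True
      then show ?thesis using add by simp
    next
      case False
      have k: "Poly_Mapping.keys (Poly_Mapping.single w c + f) = insert w (Poly_Mapping.keys f)"
        using add(1) False
        by (auto simp: in_keys_iff lookup_add lookup_single when_def split: if_splits)
      have "set (letters w) \<subseteq> carr L" "f \<in> free_alg L"
        using add(3) k by (auto simp: free_alg_def)
      then show ?thesis using add
        by (simp add: distrib_right free_act_add 1 free_act_single)
    qed
  qed
qed

lemma gen_in_free_alg: "x \<in> carr L \<Longrightarrow> gen c x \<in> free_alg L"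
  by (auto simp: gen_def free_alg_def)

lemma free_act_gen: "free_act scale rho (gen c x) m = scale c (rho x m)"
  by (simp add: gen_def free_act_single word_act_def)

end

locale closed_lie_module = lie_module +
  assumes closed: "x \<in> carr L \<Longrightarrow> y \<in> carr L \<Longrightarrow> ladd L x y \<in> carr L"
    "x \<in> carr L \<Longrightarrow> lsmult L c x \<in> carr L"
    "x \<in> carr L \<Longrightarrow> y \<in> carr L \<Longrightarrow> lbracket L x y \<in> carr L"
begin

lemma env_ideal_subset: "f \<in> env_ideal L \<Longrightarrow> f \<in> free_alg L"
  by (induction rule: env_ideal.induct)
    (auto intro!: free_alg_add free_alg_diff free_alg_mult gen_in_free_alg closed)

lemma free_act_ideal: "f \<in> env_ideal L \<Longrightarrow> free_act scale rho f m = 0"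
proof (induction arbitrary: m rule: env_ideal.induct)
  case (rel_bracket x y)
  then show ?case
    by (simp add: free_act_diff free_act_mult gen_in_free_alg free_act_gen rho_bracket)
qed (auto simp: free_act_diff free_act_add free_act_mult free_act_linear env_ideal_subset
      free_act_gen rho_add rho_smult)

lemma env_act_class:
  assumes "u \<in> env_alg L" "f \<in> u"
  shows "env_act scale rho u m = free_act scale rho f m"
proof -
  have *: "free_act scale rho g m = free_act scale rho f m" if "g \<in> u" for g
  proof -
    obtain h where h: "u = {(f, g). f \<in> free_alg L \<and> g \<in> free_alg L \<and> f - g \<in> env_ideal L} `` {h}"
      using assms(1) by (auto simp: env_alg_def quotient_def)
    have "free_act scale rho h m = free_act scale rho k m" if "k \<in> u" for k
      using that free_act_ideal[of "h - k" m] by (auto simp: h free_act_diff)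
    then show ?thesis using that assms(2) by metis
  qed
  show ?thesis unfolding env_act_def
  proof (rule the_equality)
    show "\<forall>g\<in>u. free_act scale rho g m = free_act scale rho f m" using * by (rule ballI)
  next
    fix m' assume "\<forall>g\<in>u. free_act scale rho g m = m'"
    then show "m' = free_act scale rho f m" using assms(2) by (metis (no_types))
  qed
qed

end

section \<open>Special linear Lie algebras\<close>

definition mat_trace :: "nat \<Rightarrow> complex mat \<Rightarrow> complex" where
  "mat_trace N X = (\<Sum>i<N. X $$ (i, i))"

definition sl :: "nat \<Rightarrow> complex mat lie_alg" where
  "sl N = \<lparr>carr = {X \<in> carrier_mat N N. mat_trace N X = 0},
     ladd = (+), lsmult = (\<cdot>\<^sub>m), lbracket = (\<lambda>X Y. X * Y - Y * X)\<rparr>"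

text \<open>The matrix unit \<open>A\<^bsub>i,j\<^esub>\<close> with indices counted from 1 (matrix entries in the library are
  counted from 0).\<close>

definition munit :: "nat \<Rightarrow> nat \<Rightarrow> nat \<Rightarrow> complex mat" where
  "munit N i j = mat N N (\<lambda>(a, b). if a + 1 = i \<and> b + 1 = j then 1 else 0)"

definition slH :: "nat \<Rightarrow> nat \<Rightarrow> complex mat" where
  "slH N i = munit N i i - munit N (i + 1) (i + 1)"

definition cartan :: "nat \<Rightarrow> complex mat set" where
  "cartan N = {h \<in> carr (sl N). \<forall>i<N. \<forall>j<N. i \<noteq> j \<longrightarrow> h $$ (i, j) = 0}"

text \<open>On the Cartan subalgebra of \<open>sl(N)\<close>, the fundamental weight \<open>\<omega>\<^sub>k\<close> \<open>(1 \<le> k < N)\<close> is the sum of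
  the first \<open>k\<close> diagonal entries; it is dual to the coroots by \<open>fund_weight_H\<close>.\<close>

definition fund_weight :: "nat \<Rightarrow> complex mat \<Rightarrow> complex" where
  "fund_weight k h = (\<Sum>i<k. h $$ (i, i))"

lemma fund_weight_H:
  assumes "1 \<le> k" "k < N" "1 \<le> i" "i < N"
  shows "fund_weight k (slH N i) = (if k = i then 1 else 0)"
proof -
  have "fund_weight k (slH N i)
      = (\<Sum>a<k. (if a = i - 1 then 1 else 0) - (if a = i then 1 else 0))"
    unfolding fund_weight_def slH_def munit_def
    by (rule sum.cong) (use assms in auto)
  also have "\<dots> = (\<Sum>a<k. if a = i - 1 then 1 else 0) - (\<Sum>a<k. if a = i then 1 else 0)"
    by (rule sum_subtractf)
  finally show ?thesis using assms by auto
qed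

definition weight_vector :: "'h set \<Rightarrow> (complex \<Rightarrow> 'v::ab_group_add \<Rightarrow> 'v) \<Rightarrow> ('h \<Rightarrow> 'v \<Rightarrow> 'v)
    \<Rightarrow> ('h \<Rightarrow> complex) \<Rightarrow> 'v \<Rightarrow> bool" where
  "weight_vector C scale rho mu v \<longleftrightarrow> v \<noteq> 0 \<and> (\<forall>h\<in>C. rho h v = scale (mu h) v)"

definition sl_highest_weight_vector :: "nat \<Rightarrow> (complex \<Rightarrow> 'v::ab_group_add \<Rightarrow> 'v)
    \<Rightarrow> (complex mat \<Rightarrow> 'v \<Rightarrow> 'v) \<Rightarrow> (complex mat \<Rightarrow> complex) \<Rightarrow> 'v \<Rightarrow> bool" where
  "sl_highest_weight_vector N scale rho mu v \<longleftrightarrow>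
     weight_vector (cartan N) scale rho mu v \<and>
     (\<forall>i j. 1 \<le> i \<and> i < j \<and> j \<le> N \<longrightarrow> rho (munit N i j) v = 0)"

section \<open>The semidirect sum and its embedding\<close>

definition sl_semidirect :: "nat \<Rightarrow> (complex mat \<times> complex vec) lie_alg" where
  "sl_semidirect n = \<lparr>carr = carr (sl (n + 1)) \<times> carrier_vec (n + 1),
     ladd = (\<lambda>(X, u) (Y, w). (X + Y, u + w)),
     lsmult = (\<lambda>c (X, u). (c \<cdot>\<^sub>m X, c \<cdot>\<^sub>v u)),
     lbracket = (\<lambda>(X, u) (Y, w). (X * Y - Y * X, X *\<^sub>v w - Y *\<^sub>v u))\<rparr>"

text \<open>\<open>in_sl\<close> is the inclusion of \<open>sl(n+1)\<close> as the Levi factor; \<open>gP\<close>, \<open>slE\<close>, \<open>slF\<close> are 1-based.\<close>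

definition in_sl :: "nat \<Rightarrow> complex mat \<Rightarrow> complex mat \<times> complex vec" where
  "in_sl n X = (X, 0\<^sub>v (n + 1))"

definition gP :: "nat \<Rightarrow> nat \<Rightarrow> complex mat \<times> complex vec" where
  "gP n j = (0\<^sub>m (n + 1) (n + 1), unit_vec (n + 1) (j - 1))"

definition slE :: "nat \<Rightarrow> nat \<Rightarrow> nat \<Rightarrow> complex mat" where
  "slE n p q = munit (n + 1) p (q + 1)"

definition slF :: "nat \<Rightarrow> nat \<Rightarrow> nat \<Rightarrow> complex mat" where
  "slF n p q = munit (n + 1) (q + 1) p"

text \<open>In block form, \<open>\<Phi>\<close> sends \<open>(X, u)\<close> to the matrix with first row 0, with \<open>u\<close> below the
  corner in the first column and \<open>X\<close> in the lower right block. The lemmas \<open>Phi_H\<close>, \<open>Phi_E\<close>,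
  \<open>Phi_F\<close>, \<open>Phi_P\<close>, \<open>Phi_add\<close>, \<open>Phi_smult\<close> show that it is the linear map with the prescribed
  values on the basis.\<close>

definition Phi :: "nat \<Rightarrow> complex mat \<times> complex vec \<Rightarrow> complex mat" where
  "Phi n = (\<lambda>(X, u). mat (n + 2) (n + 2) (\<lambda>(i, j).
     if i = 0 then 0 else if j = 0 then u $ (i - 1) else X $$ (i - 1, j - 1)))"

lemma Phi_H: "1 \<le> i \<Longrightarrow> i \<le> n \<Longrightarrow>
    Phi n (in_sl n (slH (n + 1) i)) = munit (n + 2) (i + 1) (i + 1) - munit (n + 2) (i + 2) (i + 2)"
  by (rule eq_matI) (auto simp: Phi_def in_sl_def slH_def munit_def)

lemma Phi_E: "1 \<le> p \<Longrightarrow> p \<le> q \<Longrightarrow> q \<le> n \<Longrightarrow>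
    Phi n (in_sl n (slE n p q)) = munit (n + 2) (p + 1) (q + 2)"
  by (rule eq_matI) (auto simp: Phi_def in_sl_def slE_def munit_def)

lemma Phi_F: "1 \<le> p \<Longrightarrow> p \<le> q \<Longrightarrow> q \<le> n \<Longrightarrow>
    Phi n (in_sl n (slF n p q)) = munit (n + 2) (q + 2) (p + 1)"
  by (rule eq_matI) (auto simp: Phi_def in_sl_def slF_def munit_def)

lemma Phi_P: "1 \<le> j \<Longrightarrow> j \<le> n + 1 \<Longrightarrow> Phi n (gP n j) = munit (n + 2) (j + 1) 1"
  by (rule eq_matI) (auto simp: Phi_def gP_def munit_def unit_vec_def)

lemma Phi_carr:
  assumes "x \<in> carr (sl_semidirect n)"
  shows "Phi n x \<in> carr (sl (n + 2))"
proof -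
  obtain X u where x: "x = (X, u)" by (cases x)
  have "(\<Sum>i<n+2. (Phi n x) $$ (i, i)) = (\<Sum>i<Suc (n+1). if i = 0 then 0 else X $$ (i - 1, i - 1))"
    by (rule sum.cong) (auto simp: Phi_def x)
  also have "\<dots> = (\<Sum>i<n+1. X $$ (i, i))"
    by (subst sum.lessThan_Suc_shift) simp
  also have "\<dots> = 0" using assms by (simp add: x sl_semidirect_def sl_def mat_trace_def)
  finally show ?thesis by (simp add: sl_def mat_trace_def) (simp add: Phi_def split_beta)
qed

lemma Phi_add:
  assumes "x \<in> carr (sl_semidirect n)" "y \<in> carr (sl_semidirect n)"
  shows "Phi n (ladd (sl_semidirect n) x y) = ladd (sl (n + 2)) (Phi n x) (Phi n y)"
  using assms by (intro eq_matI) (auto simp: Phi_def sl_semidirect_def sl_def)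

lemma Phi_smult:
  assumes "x \<in> carr (sl_semidirect n)"
  shows "Phi n (lsmult (sl_semidirect n) c x) = lsmult (sl (n + 2)) c (Phi n x)"
  using assms by (intro eq_matI) (auto simp: Phi_def sl_semidirect_def sl_def)

lemma Phi_bracket:
  assumes "x \<in> carr (sl_semidirect n)" "y \<in> carr (sl_semidirect n)"
  shows "Phi n (lbracket (sl_semidirect n) x y) = lbracket (sl (n + 2)) (Phi n x) (Phi n y)"
proof -
  obtain X u Y w where xy: "x = (X, u)" "y = (Y, w)" by (cases x; cases y)
  have c: "X \<in> carrier_mat (n+1) (n+1)" "Y \<in> carrier_mat (n+1) (n+1)"
      "u \<in> carrier_vec (n+1)" "w \<in> carrier_vec (n+1)"
    using assms by (auto simp: xy sl_semidirect_def sl_def)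
  have prod: "(Phi n (Z, s) * Phi n (Z', s')) $$ (i, j) =
      (if i = 0 then 0 else if j = 0 then (Z *\<^sub>v s') $ (i - 1) else (Z * Z') $$ (i - 1, j - 1))"
    if "i < n + 2" "j < n + 2" "Z \<in> carrier_mat (n+1) (n+1)" "Z' \<in> carrier_mat (n+1) (n+1)"
       "s \<in> carrier_vec (n+1)" "s' \<in> carrier_vec (n+1)" for i j Z Z' s s'
  proof -
    have "(Phi n (Z, s) * Phi n (Z', s')) $$ (i, j)
        = (\<Sum>k<Suc (n+1). Phi n (Z, s) $$ (i, k) * Phi n (Z', s') $$ (k, j))"
      using that(1,2) by (simp add: Phi_def scalar_prod_def atLeast0LessThan)
    also have "\<dots> = (\<Sum>k<n+1. Phi n (Z, s) $$ (i, Suc k) * Phi n (Z', s') $$ (Suc k, j))"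
      using that(1,2) by (subst sum.lessThan_Suc_shift) (simp add: Phi_def)
    also have "\<dots> = (\<Sum>k<n+1. if i = 0 then 0 else
        Z $$ (i - 1, k) * (if j = 0 then s' $ k else Z' $$ (k, j - 1)))"
      by (rule sum.cong) (use that(1,2) in \<open>auto simp: Phi_def\<close>)
    also have "\<dots> = (if i = 0 then 0 else if j = 0 then (Z *\<^sub>v s') $ (i - 1)
        else (Z * Z') $$ (i - 1, j - 1))"
      using that by (auto simp: scalar_prod_def atLeast0LessThan intro!: sum.cong)
    finally show ?thesis .
  qed
  show ?thesis
  proof (rule eq_matI)
    fix i j
    assume "i < dim_row (lbracket (sl (n + 2)) (Phi n x) (Phi n y))"
      and "j < dim_col (lbracket (sl (n + 2)) (Phi n x) (Phi n y))"
    then have ij: "i < n + 2" "j < n + 2" by (simp_all add: sl_def Phi_def xy)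
    have "lbracket (sl (n + 2)) (Phi n x) (Phi n y) $$ (i, j)
        = (Phi n (X, u) * Phi n (Y, w)) $$ (i, j) - (Phi n (Y, w) * Phi n (X, u)) $$ (i, j)"
      using ij by (simp add: sl_def xy Phi_def)
    then show "Phi n (lbracket (sl_semidirect n) x y) $$ (i, j)
        = lbracket (sl (n + 2)) (Phi n x) (Phi n y) $$ (i, j)"
      unfolding prod[OF ij c] prod[OF ij c(2,1,4,3)]
      using ij c by (auto simp: Phi_def sl_semidirect_def xy)
  qed (simp_all add: Phi_def sl_semidirect_def sl_def xy)
qed

lemma Phi_inj: "inj_on (Phi n) (carr (sl_semidirect n))"
proof (rule inj_onI)
  fix x y
  assume xy: "x \<in> carr (sl_semidirect n)" "y \<in> carr (sl_semidirect n)" "Phi n x = Phi n y"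
  obtain X u Y w where x: "x = (X, u)" "y = (Y, w)" by (cases x; cases y)
  have e: "Phi n x $$ (i, j) = Phi n y $$ (i, j)" for i j using xy by simp
  have "X = Y"
  proof (rule eq_matI)
    fix i j assume "i < dim_row Y" "j < dim_col Y"
    then show "X $$ (i, j) = Y $$ (i, j)"
      using e[of "i+1" "j+1"] xy(1,2) by (auto simp: Phi_def x sl_semidirect_def sl_def)
  qed (use xy in \<open>auto simp: x sl_semidirect_def sl_def\<close>)
  moreover have "u = w"
  proof (rule eq_vecI)
    fix i assume "i < dim_vec w"
    then show "u $ i = w $ i"
      using e[of "i+1" 0] xy(1,2) by (auto simp: Phi_def x sl_semidirect_def sl_def)
  qed (use xy in \<open>auto simp: x sl_semidirect_def sl_def\<close>)
  ultimately show "x = y" by (simp add: x)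
qed

definition restrict_Phi :: "nat \<Rightarrow> (complex mat \<Rightarrow> 'v \<Rightarrow> 'v) \<Rightarrow> complex mat \<times> complex vec \<Rightarrow> 'v \<Rightarrow> 'v"
  where "restrict_Phi n rho x = rho (Phi n x)"

lemma sl_semidirect_closed:
  assumes "x \<in> carr (sl_semidirect n)" "y \<in> carr (sl_semidirect n)"
  shows "ladd (sl_semidirect n) x y \<in> carr (sl_semidirect n)"
    and "lsmult (sl_semidirect n) c x \<in> carr (sl_semidirect n)"
    and "lbracket (sl_semidirect n) x y \<in> carr (sl_semidirect n)"
proof -
  obtain X u Y w where xy: "x = (X, u)" "y = (Y, w)" by (cases x; cases y)
  have c: "X \<in> carrier_mat (n+1) (n+1)" "Y \<in> carrier_mat (n+1) (n+1)"
      "u \<in> carrier_vec (n+1)" "w \<in> carrier_vec (n+1)"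
      and tr: "(\<Sum>i<n+1. X $$ (i, i)) = 0" "(\<Sum>i<n+1. Y $$ (i, i)) = 0"
    using assms by (auto simp: xy sl_semidirect_def sl_def mat_trace_def)
  have "(\<Sum>i<n+1. (X + Y) $$ (i, i)) = (\<Sum>i<n+1. X $$ (i, i) + Y $$ (i, i))"
    by (rule sum.cong) (use c in auto)
  also have "\<dots> = 0" using tr by (simp only: sum.distrib) simp
  finally show "ladd (sl_semidirect n) x y \<in> carr (sl_semidirect n)"
    using c by (simp add: xy sl_semidirect_def sl_def mat_trace_def)
  have "(\<Sum>i<n+1. (c \<cdot>\<^sub>m X) $$ (i, i)) = (\<Sum>i<n+1. c * X $$ (i, i))"
    by (rule sum.cong) (use c in auto)
  also have "\<dots> = 0" using tr(1) by (simp only: sum_distrib_left[symmetric]) simp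
  finally show "lsmult (sl_semidirect n) c x \<in> carr (sl_semidirect n)"
    using c by (simp add: xy sl_semidirect_def sl_def mat_trace_def)
  have "(\<Sum>i<n+1. (X * Y - Y * X) $$ (i, i))
      = (\<Sum>i<n+1. (\<Sum>k<n+1. X $$ (i, k) * Y $$ (k, i)) - (\<Sum>k<n+1. Y $$ (i, k) * X $$ (k, i)))"
    by (rule sum.cong) (use c in \<open>auto simp: scalar_prod_def atLeast0LessThan\<close>)
  also have "\<dots> = (\<Sum>i<n+1. \<Sum>k<n+1. X $$ (i, k) * Y $$ (k, i))
      - (\<Sum>i<n+1. \<Sum>k<n+1. Y $$ (i, k) * X $$ (k, i))"
    by (rule sum_subtractf)
  also have "(\<Sum>i<n+1. \<Sum>k<n+1. Y $$ (i, k) * X $$ (k, i))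
      = (\<Sum>i<n+1. \<Sum>k<n+1. X $$ (i, k) * Y $$ (k, i))"
    by (subst sum.swap) (simp only: mult.commute)
  finally have "mat_trace (n + 1) (X * Y - Y * X) = 0" by (simp add: mat_trace_def)
  moreover have "X * Y - Y * X \<in> carrier_mat (n + 1) (n + 1)"
    using c by (intro minus_carrier_mat mult_carrier_mat)
  ultimately show "lbracket (sl_semidirect n) x y \<in> carr (sl_semidirect n)"
    using c by (simp add: xy sl_semidirect_def sl_def)
qed

lemma restrict_Phi_module:
  assumes "lie_module (sl (n + 2)) scale rho"
  shows "closed_lie_module (sl_semidirect n) scale (restrict_Phi n rho)"
proof -
  interpret lie_module "sl (n + 2)" scale rho by fact
  let ?L = "sl_semidirect n"
  have "lie_module_axioms ?L scale (restrict_Phi n rho)"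
  proof (rule lie_module_axioms.intro)
    show "\<exists>B. finite_dimensional_vector_space scale B" by (rule finite_dim)
  next
    fix x assume x: "x \<in> carr ?L"
    then show "Vector_Spaces.linear scale scale (restrict_Phi n rho x)"
      using rho_linear[OF Phi_carr[OF x]] by (simp add: restrict_Phi_def[abs_def])
    fix c m
    show "restrict_Phi n rho (lsmult ?L c x) m = scale c (restrict_Phi n rho x m)"
      unfolding restrict_Phi_def Phi_smult[OF x] by (rule rho_smult[OF Phi_carr[OF x]])
  next
    fix x y m assume x: "x \<in> carr ?L" and y: "y \<in> carr ?L"
    show "restrict_Phi n rho (ladd ?L x y) m = restrict_Phi n rho x m + restrict_Phi n rho y m"
      unfolding restrict_Phi_def Phi_add[OF x y] by (rule rho_add[OF x[THEN Phi_carr] y[THEN Phi_carr]])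
    show "restrict_Phi n rho (lbracket ?L x y) m
        = restrict_Phi n rho x (restrict_Phi n rho y m) - restrict_Phi n rho y (restrict_Phi n rho x m)"
      unfolding restrict_Phi_def Phi_bracket[OF x y]
      by (rule rho_bracket[OF x[THEN Phi_carr] y[THEN Phi_carr]])
  qed
  then show ?thesis
    by (intro closed_lie_module.intro lie_module.intro closed_lie_module_axioms.intro
        vector_space_axioms sl_semidirect_closed)
qed

end

theory Submission
  imports Defs
begin

text \<open>The image of \<open>\<Phi>\<close> misses very little of \<open>sl(n+2)\<close>: modulo this image, every matrix is a
  multiple of the coroot \<open>H\<^sub>1 = A\<^bsub>1,1\<^esub> - A\<^bsub>2,2\<^esub>\<close> plus a matrix living strictly to the right of
  the corner in the first row (\<open>sl_decompose\<close>). A highest weight vector \<open>v\<close> is an eigenvector of the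
  former and is killed by the latter, so \<open>\<U>(\<gg>)v\<close> contains \<open>Xv\<close> for every \<open>X\<close> in
  \<open>sl(n+2)\<close>. Commuting \<open>X\<close> past the letters of a word from \<open>\<gg>\<close> produces only words applied to
  such vectors, so \<open>\<U>(\<gg>)v\<close> is stable under all of \<open>sl(n+2)\<close>
  (\<open>generated_subspace_invariant\<close>). It is not zero, hence it is everything by irreducibility. The weight of \<open>v\<close> for the Levi
  factor is read off from \<open>\<omega>\<^sub>k \<circ> \<Phi> = \<omega>\<^bsub>k-1\<^esub>\<close>, where \<open>\<omega>\<^sub>0 = 0\<close> makes the
  coefficient \<open>\<lambda>\<^sub>1\<close> disappear.\<close>

section \<open>Subspaces generated by a vector\<close>

context lie_module
begin

text \<open>Let \<open>W\<close> be the smallest subspace containing \<open>v\<close> and stable under a set \<open>K\<close> of elements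
  of \<open>L\<close>. To see that it is stable under all of \<open>L\<close>, it is enough to look at \<open>v\<close> itself: the
  vectors of \<open>W\<close> that \<open>L\<close> maps into \<open>W\<close> form a subspace, which is stable under \<open>K\<close> because
  \<open>X(xw) = x(Xw) + [X,x]w\<close>.\<close>

lemma generated_subspace_invariant:
  assumes W: "subspace W" and K: "K \<subseteq> carr L"
    and stable: "\<And>x w. x \<in> K \<Longrightarrow> w \<in> W \<Longrightarrow> rho x w \<in> W"
    and least: "\<And>S. subspace S \<Longrightarrow> v \<in> S \<Longrightarrow> (\<And>x w. x \<in> K \<Longrightarrow> w \<in> S \<Longrightarrow> rho x w \<in> S) \<Longrightarrow> W \<subseteq> S"
    and bracket: "\<And>X x. X \<in> carr L \<Longrightarrow> x \<in> K \<Longrightarrow> lbracket L X x \<in> carr L"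
    and v: "v \<in> W" "\<And>X. X \<in> carr L \<Longrightarrow> rho X v \<in> W"
    and Xw: "X \<in> carr L" "w \<in> W"
  shows "rho X w \<in> W"
proof -
  let ?S = "{w \<in> W. \<forall>X\<in>carr L. rho X w \<in> W}"
  have "W \<subseteq> ?S"
  proof (rule least)
    show "subspace ?S"
      using W by (auto intro!: subspaceI simp: subspace_0 subspace_add subspace_scale
          lin_hom[OF rho_linear])
    show "v \<in> ?S" using v by simp
  next
    fix x w assume x: "x \<in> K" and w: "w \<in> ?S"
    have "rho X (rho x w) \<in> W" if X: "X \<in> carr L" for X
    proof -
      have "rho X (rho x w) = rho x (rho X w) + rho (lbracket L X x) w"
        using X x K by (simp add: rho_bracket subset_iff)
      also have "\<dots> \<in> W"
        using subspace_add[OF W stable[OF x]] X x w bracket[OF X x] by blast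
      finally show ?thesis .
    qed
    then show "rho x w \<in> ?S" using stable x w by simp
  qed
  then show ?thesis using Xw by blast
qed

lemma free_act_in_stable_subspace:
  assumes S: "subspace S" and stable: "\<And>x w. x \<in> carr L \<Longrightarrow> w \<in> S \<Longrightarrow> rho x w \<in> S"
    and "f \<in> free_alg L" "m \<in> S"
  shows "free_act scale rho f m \<in> S"
proof -
  have "foldr rho xs m \<in> S" if "set xs \<subseteq> carr L" for xs
    using that by (induction xs) (use stable \<open>m \<in> S\<close> in auto)
  then show ?thesis unfolding free_act_def word_act_def
    using \<open>f \<in> free_alg L\<close> by (intro subspace_sum subspace_scale S) (auto simp: free_alg_def)
qed

lemma subspace_free_act: "subspace {free_act scale rho f m | f. f \<in> free_alg L}" (is "subspace ?W")
proof (rule subspaceI)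
  show "0 \<in> ?W" using free_alg_zero[of L] by (force simp: free_act_def)
  show "a + b \<in> ?W" if "a \<in> ?W" "b \<in> ?W" for a b
    using that by (auto simp flip: free_act_add intro: free_alg_add)
  show "scale c a \<in> ?W" if a: "a \<in> ?W" for c a
  proof -
    \<comment> \<open>The scalar \<open>c\<close> acts as the multiple \<open>c\<close> of the empty word.\<close>
    let ?c = "Poly_Mapping.single (Word []) c"
    obtain f where f: "a = free_act scale rho f m" "f \<in> free_alg L" using a by blast
    have c: "?c \<in> free_alg L" by (auto simp: free_alg_def)
    have "scale c a = free_act scale rho (?c * f) m"
      by (simp add: free_act_mult[OF c f(2)] free_act_single word_act_def f(1))
    then show ?thesis using free_alg_mult[OF c f(2)] by blast
  qed
qed

lemma free_act_stable:
  assumes "x \<in> carr L" "w \<in> {free_act scale rho f m | f. f \<in> free_alg L}"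
  shows "rho x w \<in> {free_act scale rho f m | f. f \<in> free_alg L}"
proof -
  obtain f where f: "w = free_act scale rho f m" "f \<in> free_alg L" using assms(2) by blast
  have "rho x w = free_act scale rho (gen 1 x * f) m"
    using assms(1) f by (simp add: free_act_mult gen_in_free_alg free_act_gen)
  then show ?thesis using assms(1) f(2) by (blast intro: free_alg_mult gen_in_free_alg)
qed

lemma generator_in_free_act: "m \<in> {free_act scale rho f m | f. f \<in> free_alg L}"
proof -
  have "m = free_act scale rho (Poly_Mapping.single (Word []) 1) m"
    by (simp add: free_act_single word_act_def)
  moreover have "Poly_Mapping.single (Word []) 1 \<in> free_alg L" by (simp add: free_alg_def)
  ultimately show ?thesis by blast
qed

end

text \<open>For cyclicity one may compute with representatives in the free algebra. The inductively
  generated ideal contains \<open>0\<close> only through one of its generators, so the carrier has to be inhabited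
  for the classes to contain their representatives.\<close>

lemma (in closed_lie_module) cyclic_lie_moduleI:
  assumes "carr L \<noteq> {}" "\<And>m. m \<in> {free_act scale rho f v | f. f \<in> free_alg L}"
  shows "cyclic_lie_module L scale rho v"
proof -
  obtain x where "x \<in> carr L" using assms(1) by blast
  then have zero: "0 \<in> env_ideal L"
    using ideal_left[OF free_alg_zero rel_smult[of x L 1]] by simp
  have "m \<in> {env_act scale rho u v | u. u \<in> env_alg L}" for m
  proof -
    obtain f where f: "m = free_act scale rho f v" "f \<in> free_alg L" using assms(2)[of m] by blast
    let ?R = "{(f, g). f \<in> free_alg L \<and> g \<in> free_alg L \<and> f - g \<in> env_ideal L}"
    have u: "?R `` {f} \<in> env_alg L" "f \<in> ?R `` {f}"
      unfolding env_alg_def by (rule quotientI, rule f(2)) (use f(2) zero in simp)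
    have "m = env_act scale rho (?R `` {f}) v" using env_act_class[OF u] f(1) by simp
    then show ?thesis using u(1) by blast
  qed
  then show ?thesis unfolding cyclic_lie_module_def using lie_module_axioms by blast
qed

section \<open>The complement of the image of the embedding\<close>

lemma sl_bracket_closed:
  assumes "X \<in> carr (sl (n + 2))" "Y \<in> carr (sl (n + 2))"
  shows "lbracket (sl (n + 2)) X Y \<in> carr (sl (n + 2))"
proof -
  \<comment> \<open>\<open>sl(n+2)\<close> is the Levi factor of the semidirect sum of rank \<open>n+1\<close>.\<close>
  have "in_sl (n + 1) X \<in> carr (sl_semidirect (n + 1))" "in_sl (n + 1) Y \<in> carr (sl_semidirect (n + 1))"
    using assms by (simp_all add: in_sl_def sl_semidirect_def)
  from sl_semidirect_closed(3)[OF this] show ?thesis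
    by (simp add: in_sl_def sl_semidirect_def sl_def)
qed

definition first_row :: "nat \<Rightarrow> nat \<Rightarrow> (nat \<Rightarrow> complex) \<Rightarrow> complex mat" where
  "first_row N k r = mat N N (\<lambda>(i, j). if i = 0 \<and> 0 < j \<and> j < k then r j else 0)"

lemma first_row_carr: "first_row N k r \<in> carr (sl N)"
  by (auto simp: first_row_def sl_def mat_trace_def intro!: sum.neutral)

lemma munit_carr: "i \<noteq> j \<Longrightarrow> munit N i j \<in> carr (sl N)"
  by (auto simp: munit_def sl_def mat_trace_def intro!: sum.neutral)

lemma slH_cartan:
  assumes "1 \<le> i" "i < N"
  shows "slH N i \<in> cartan N"
proof -
  have "mat_trace N (slH N i) = (\<Sum>k<N. (if k = i - 1 then 1 else 0) - (if k = i then 1 else 0))"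
    unfolding mat_trace_def by (rule sum.cong) (use assms in \<open>auto simp: slH_def munit_def\<close>)
  also have "\<dots> = 0" using assms by (simp add: sum_subtractf)
  finally show ?thesis by (auto simp: cartan_def sl_def slH_def munit_def)
qed

text \<open>The preimage takes its vector from the first column of \<open>X\<close> and its matrix from the lower right
  block, corrected in its corner to have trace zero; the multiple of \<open>H\<^sub>1\<close> both compensates for the
  correction and supplies the corner of \<open>X\<close>.\<close>

lemma sl_decompose:
  assumes X: "X \<in> carr (sl (n + 2))"
  obtains x where "x \<in> carr (sl_semidirect n)"
    "X = Phi n x + (X $$ (0, 0) \<cdot>\<^sub>m slH (n + 2) 1 + first_row (n + 2) (n + 2) (\<lambda>j. X $$ (0, j)))"
proof -
  let ?Y = "mat (n + 1) (n + 1) (\<lambda>(i, j). X $$ (i + 1, j + 1) + (if i = 0 \<and> j = 0 then X $$ (0, 0) else 0))"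
  let ?u = "vec (n + 1) (\<lambda>i. X $$ (i + 1, 0))"
  have "mat_trace (n + 1) ?Y
      = (\<Sum>i<n + 1. X $$ (Suc i, Suc i) + (if i = 0 then X $$ (0, 0) else 0))"
    unfolding mat_trace_def by (rule sum.cong) auto
  also have "\<dots> = (\<Sum>i<n + 1. X $$ (Suc i, Suc i)) + X $$ (0, 0)"
    by (simp only: sum.distrib) (simp del: sum.lessThan_Suc)
  also have "\<dots> = (\<Sum>i<Suc (n + 1). X $$ (i, i))"
    by (simp only: sum.lessThan_Suc_shift add.commute)
  also have "\<dots> = 0" using X by (simp add: sl_def mat_trace_def)
  finally have "(?Y, ?u) \<in> carr (sl_semidirect n)" by (simp add: sl_semidirect_def sl_def)
  moreover have "X = Phi n (?Y, ?u)
      + (X $$ (0, 0) \<cdot>\<^sub>m slH (n + 2) 1 + first_row (n + 2) (n + 2) (\<lambda>j. X $$ (0, j)))"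
    using X by (intro eq_matI) (auto simp: Phi_def slH_def munit_def first_row_def sl_def le_Suc_eq)
  ultimately show ?thesis by (rule that)
qed

text \<open>The induction on \<open>k\<close> replaces an expansion of the row into matrix units: a matrix type that holds
  all sizes has no zero, hence no finite sums, and the action is additive for two summands at a
  time.\<close>

lemma first_row_kills:
  assumes "lie_module (sl N) scale rho"
    and kills: "\<And>j. 1 < j \<Longrightarrow> j \<le> N \<Longrightarrow> rho (munit N 1 j) v = 0"
    and "k \<le> N"
  shows "rho (first_row N k r) v = 0"
proof -
  interpret lie_module "sl N" scale rho by fact
  have sl_ops: "ladd (sl N) = (+)" "lsmult (sl N) = (\<cdot>\<^sub>m)" by (simp_all add: sl_def)
  show ?thesis using \<open>k \<le> N\<close>
  proof (induction k)
    case 0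
    have "first_row N 0 r = 0 \<cdot>\<^sub>m first_row N 0 r" by (rule eq_matI) (auto simp: first_row_def)
    then show ?case
      using rho_smult[OF first_row_carr[of N 0 r], of 0 v] by (simp add: sl_ops)
  next
    case (Suc k)
    show ?case
    proof (cases "k = 0")
      case True
      then have "first_row N (Suc k) r = first_row N k r"
        by (intro eq_matI) (auto simp: first_row_def)
      then show ?thesis using Suc by simp
    next
      case False
      have m: "munit N 1 (k + 1) \<in> carr (sl N)" using False by (intro munit_carr) simp
      have rm: "r k \<cdot>\<^sub>m munit N 1 (k + 1) \<in> carr (sl N)"
        using False by (auto simp: sl_def munit_def mat_trace_def intro!: sum.neutral)
      have "first_row N (Suc k) r = first_row N k r + r k \<cdot>\<^sub>m munit N 1 (k + 1)"
        using Suc.prems False by (intro eq_matI) (auto simp: first_row_def munit_def less_Suc_eq)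
      then show ?thesis
        using rho_add[OF first_row_carr[of N k r] rm, of v] rho_smult[OF m, of "r k" v] Suc False
          kills[of "k + 1"] by (simp add: sl_ops)
    qed
  qed
qed

section \<open>Weights along the embedding\<close>

lemma Phi_cartan:
  assumes "h \<in> cartan (n + 1)"
  shows "Phi n (in_sl n h) \<in> cartan (n + 2)"
proof -
  have "in_sl n h \<in> carr (sl_semidirect n)"
    using assms by (simp add: in_sl_def sl_semidirect_def cartan_def)
  from Phi_carr[OF this] show ?thesis
    using assms by (auto simp: cartan_def Phi_def in_sl_def)
qed

lemma fund_weight_Phi:
  assumes "k < n + 2"
  shows "fund_weight (Suc k) (Phi n (in_sl n h)) = fund_weight k h"
  unfolding fund_weight_def
  by (subst sum.lessThan_Suc_shift) (use assms in \<open>auto simp: Phi_def in_sl_def intro!: sum.cong\<close>)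

lemma dominant_weight_Phi:
  "(\<Sum>i = 1..n + 1. of_nat (lam i) * fund_weight i (Phi n (in_sl n h)))
    = (\<Sum>k = 2..n + 1. of_nat (lam k) * fund_weight (k - 1) h)"
proof -
  have *: "fund_weight i (Phi n (in_sl n h)) = fund_weight (i - 1) h" if "1 \<le> i" "i \<le> n + 1" for i
    using fund_weight_Phi[of "i - 1" n h] that by simp
  have "(\<Sum>i = 1..n + 1. of_nat (lam i) * fund_weight i (Phi n (in_sl n h)))
      = (\<Sum>i = 1..n + 1. of_nat (lam i) * fund_weight (i - 1) h)"
    by (rule sum.cong) (simp_all add: *)
  also have "\<dots> = (\<Sum>k = 2..n + 1. of_nat (lam k) * fund_weight (k - 1) h)"
    by (subst sum.atLeast_Suc_atMost) (simp_all add: fund_weight_def numeral_2_eq_2)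
  finally show ?thesis .
qed

section \<open>Cyclicity of the restricted module\<close>

theorem theorem4p2:
  fixes n :: nat and lam :: "nat \<Rightarrow> nat"
    and scale :: "complex \<Rightarrow> 'v::ab_group_add \<Rightarrow> 'v"
    and rho :: "complex mat \<Rightarrow> 'v \<Rightarrow> 'v" and v :: 'v
  assumes "1 \<le> n"
    and "irreducible_lie_module (sl (n + 2)) scale rho"
    and "sl_highest_weight_vector (n + 2) scale rho
           (\<lambda>h. \<Sum>i = 1..n + 1. of_nat (lam i) * fund_weight i h) v"
  shows "cyclic_lie_module (sl_semidirect n) scale (restrict_Phi n rho) v
    \<and> weight_vector (cartan (n + 1)) scale (\<lambda>h. restrict_Phi n rho (in_sl n h))
        (\<lambda>h. \<Sum>k = 2..n + 1. of_nat (lam k) * fund_weight (k - 1) h) v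
    \<and> (\<forall>i\<in>{1..n}. restrict_Phi n rho (in_sl n (slH (n + 1) i)) v = scale (of_nat (lam (i + 1))) v)"
proof -
  let ?L = "sl (n + 2)" and ?G = "sl_semidirect n"
  define mu where "mu h = (\<Sum>i = 1..n + 1. of_nat (lam i) * fund_weight i h)" for h
  have mod: "lie_module ?L scale rho" using assms(2) by (simp add: irreducible_lie_module_def)
  interpret V: lie_module ?L scale rho by (rule mod)
  interpret R: closed_lie_module ?G scale "restrict_Phi n rho" by (rule restrict_Phi_module[OF mod])
  have v: "v \<noteq> 0" "\<And>h. h \<in> cartan (n + 2) \<Longrightarrow> rho h v = scale (mu h) v"
    "\<And>j. 1 < j \<Longrightarrow> j \<le> n + 2 \<Longrightarrow> rho (munit (n + 2) 1 j) v = 0"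
    using assms(3) by (auto simp: sl_highest_weight_vector_def weight_vector_def mu_def)
  have sl_ops: "ladd ?L = (+)" "lsmult ?L = (\<cdot>\<^sub>m)" by (simp_all add: sl_def)

  define W where "W = {free_act scale (restrict_Phi n rho) f v | f. f \<in> free_alg ?G}"
  have W: "V.subspace W" unfolding W_def by (rule R.subspace_free_act)
  have vW: "v \<in> W" unfolding W_def by (rule R.generator_in_free_act)
  have stable: "rho (Phi n x) w \<in> W" if "x \<in> carr ?G" "w \<in> W" for x w
    using R.free_act_stable that by (simp add: restrict_Phi_def W_def)
  have Xv: "rho X v \<in> W" if X: "X \<in> carr ?L" for X
  proof -
    obtain x where x: "x \<in> carr ?G" and dec:
      "X = Phi n x + (X $$ (0, 0) \<cdot>\<^sub>m slH (n + 2) 1 + first_row (n + 2) (n + 2) (\<lambda>j. X $$ (0, j)))"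
      using sl_decompose[OF X] .
    let ?H = "slH (n + 2) 1" and ?r = "first_row (n + 2) (n + 2) (\<lambda>j. X $$ (0, j))"
    have H: "?H \<in> cartan (n + 2)" by (rule slH_cartan) auto
    have closed: "A + B \<in> carr ?L" "c \<cdot>\<^sub>m A \<in> carr ?L" if "A \<in> carr ?L" "B \<in> carr ?L" for A B c
      using that sl_semidirect_closed(1,2)[of "in_sl (n + 1) A" "n + 1" "in_sl (n + 1) B"]
      by (auto simp: in_sl_def sl_semidirect_def sl_ops sl_def)
    have c: "?H \<in> carr ?L" "X $$ (0, 0) \<cdot>\<^sub>m ?H \<in> carr ?L" "?r \<in> carr ?L"
      using H closed(2) by (auto simp: cartan_def first_row_carr)
    have "rho X v = rho (Phi n x) v + (scale (X $$ (0, 0)) (rho ?H v) + rho ?r v)"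
      using V.rho_add[OF Phi_carr[OF x] closed(1)[OF c(2,3)]] V.rho_add[OF c(2,3)]
        V.rho_smult[OF c(1)] by (subst dec) (simp only: sl_ops)
    also have "\<dots> = rho (Phi n x) v + scale (X $$ (0, 0)) (scale (mu ?H) v)"
      using first_row_kills[OF mod v(3)] v(2)[OF H] by simp
    also have "\<dots> \<in> W"
      by (intro V.subspace_add[OF W] V.subspace_scale[OF W] stable x vW)
    finally show ?thesis .
  qed
  have "rho X w \<in> W" if "X \<in> carr ?L" "w \<in> W" for X w
  proof (rule V.generated_subspace_invariant[where K = "Phi n ` carr ?G" and v = v])
    show "W \<subseteq> S" if "V.subspace S" "v \<in> S"
      and st: "\<And>x w. x \<in> Phi n ` carr ?G \<Longrightarrow> w \<in> S \<Longrightarrow> rho x w \<in> S" for S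
      using R.free_act_in_stable_subspace[OF that(1) _ _ that(2)] st
      by (auto simp: W_def restrict_Phi_def)
    show "lbracket ?L X x \<in> carr ?L" if "X \<in> carr ?L" "x \<in> Phi n ` carr ?G" for X x
      using that sl_bracket_closed Phi_carr by blast
  qed (use W vW Xv stable that Phi_carr in auto)
  then have "W = {0} \<or> W = UNIV"
    using assms(2) W unfolding irreducible_lie_module_def by blast
  then have "W = UNIV" using v(1) vW by blast
  moreover have "gP n 1 \<in> carr ?G" by (simp add: gP_def sl_semidirect_def sl_def mat_trace_def)
  then have "carr ?G \<noteq> {}" by blast
  ultimately have cyclic: "cyclic_lie_module ?G scale (restrict_Phi n rho) v"
    by (intro R.cyclic_lie_moduleI) (auto simp: W_def)

  have weight: "restrict_Phi n rho (in_sl n h) v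
      = scale (\<Sum>k = 2..n + 1. of_nat (lam k) * fund_weight (k - 1) h) v" if "h \<in> cartan (n + 1)" for h
    using v(2)[OF Phi_cartan[OF that]] by (simp only: restrict_Phi_def mu_def dominant_weight_Phi)
  have "restrict_Phi n rho (in_sl n (slH (n + 1) i)) v = scale (of_nat (lam (i + 1))) v"
    if i: "i \<in> {1..n}" for i
  proof -
    have "(\<Sum>k = 2..n + 1. of_nat (lam k) * fund_weight (k - 1) (slH (n + 1) i))
        = (\<Sum>k = 2..n + 1. if k = i + 1 then complex_of_nat (lam k) else 0)"
      by (rule sum.cong) (use i in \<open>auto simp: fund_weight_H split: if_splits\<close>)
    also have "\<dots> = of_nat (lam (i + 1))" using i by simp
    finally show ?thesis using weight[OF slH_cartan[of i "n + 1"]] i by simp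
  qed
  then show ?thesis using cyclic weight v(1) by (auto simp: weight_vector_def)
qed

end
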